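(* For $m$ ranging over the primes $m\equiv 1\pmod 4$ such that $3$ is a primitive root modulo $m$, for every $\epsilon>0$ we have, as $m\to\infty$, $$\sigma(0,1)=\frac{m}{6}+O_\epsilon\left(m^{1/2+\epsilon}\right),$$ where the implied constant depends only on $\epsilon$.
   Context: Let $a_j(m)\in\{0,1,2\}$ ($j\ge1$) be the digits of the base $3$ expansion of $1/m$, i.e. the unique integers with $0\le a_j(m)<3$ and $\frac1m=\sum_{j=1}^\infty \frac{a_j(m)}{3^j}$. The quantity $\sigma(0,1)$ depends on $m$ and is defined by $$\sigma(0,1) := \#\{1\le j\le m-1 : m\,a_j(m)\equiv 0\pmod 3 \text{ and } 2\mid j\}.$$ An integer is a primitive root modulo $m$ if its class generates $(\mathbb{Z}/m\mathbb{Z})^\times$. *)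

theory Defs
  imports "HOL-Number_Theory.Number_Theory" "HOL-Library.Landau_Symbols"
begin

text \<open>Base 3 digit sequences of \<open>1/m\<close>, indexed from \<open>j = 1\<close>; the unused entry at index 0 is
  normalised to 0 so that the sequence is unique whenever \<open>1/m\<close> has a unique expansion.\<close>

definition is_ternary_expansion :: "nat \<Rightarrow> (nat \<Rightarrow> int) \<Rightarrow> bool" where
  "is_ternary_expansion m a \<longleftrightarrow>
     a 0 = 0 \<and> (\<forall>j\<ge>1. 0 \<le> a j \<and> a j < 3) \<and>
     (\<lambda>i. real_of_int (a (Suc i)) / 3 ^ Suc i) sums (1 / real m)"

definition ternary_digit :: "nat \<Rightarrow> nat \<Rightarrow> int" where
  "ternary_digit m = (THE a. is_ternary_expansion m a)"

definition sigma01 :: "nat \<Rightarrow> nat" where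
  "sigma01 m = card {j \<in> {1..m - 1}. [int m * ternary_digit m j = 0] (mod 3) \<and> even j}"

lemma ternary_expansion_unique:
  assumes "is_ternary_expansion m a" and mpos: "m > 0" and m: "\<And>n. \<not> m dvd 3 ^ n"
  shows "a = (\<lambda>j. if j = 0 then 0 else \<lfloor>3 ^ j / real m\<rfloor> - 3 * \<lfloor>3 ^ (j - 1) / real m\<rfloor>)"
proof -
  have a0: "a 0 = 0" and lo: "\<And>j. j \<ge> 1 \<Longrightarrow> 0 \<le> a j" and hi: "\<And>j. j \<ge> 1 \<Longrightarrow> a j \<le> 2"
    and s: "(\<lambda>i. real_of_int (a (Suc i)) / 3 ^ Suc i) sums (1 / real m)"
    using assms(1) unfolding is_ternary_expansion_def by (blast, blast, fastforce, blast)
  define N where "N = rec_nat (0::int) (\<lambda>n x. 3 * x + a (Suc n))"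
  have N0: "N 0 = 0" and NS: "\<And>n. N (Suc n) = 3 * N n + a (Suc n)" by (simp_all add: N_def)
  have tail: "(\<lambda>i. real_of_int (a (Suc (n + i))) / 3 ^ Suc i) sums (3 ^ n / real m - N n)" for n
  proof (induction n)
    case 0 then show ?case using s by (simp add: N0)
  next
    case (Suc n)
    have 1: "(\<lambda>i. real_of_int (a (Suc (n + Suc i))) / 3 ^ Suc (Suc i)) sums
        (3 ^ n / real m - N n - a (Suc n) / 3)"
      using Suc
        sums_Suc_iff[of "\<lambda>i. real_of_int (a (Suc (n + i))) / 3 ^ Suc i"] by simp
    have 2: "3 * (real_of_int (a (Suc (n + Suc i))) / 3 ^ Suc (Suc i)) =
        real_of_int (a (Suc (Suc n + i))) / 3 ^ Suc i" for i
      by simp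
    have 3: "3 * (3 ^ n / real m - N n - a (Suc n) / 3) = 3 ^ Suc n / real m - N (Suc n)"
      by (simp add: NS algebra_simps)
    from sums_mult[OF 1, of 3] show ?case unfolding 2 3 .
  qed
  have fl: "\<lfloor>3 ^ n / real m\<rfloor> = N n" for n
  proof -
    have g: "(\<lambda>i. 2 / 3 ^ Suc i :: real) sums 1"
      using sums_mult[OF geometric_sums[of "1/3::real"], of "2/3"]
      by (simp add: power_divide field_simps)
    have "0 \<le> 3 ^ n / real m - N n"
      by (rule sums_le[OF _ sums_zero tail]) (use lo in auto)
    moreover have "3 ^ n / real m - N n \<le> 1"
      by (rule sums_le[OF _ tail g]) (use hi in \<open>auto intro!: divide_right_mono\<close>)
    moreover have "3 ^ n / real m - N n \<noteq> 1"
    proof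
      assume "3 ^ n / real m - N n = 1"
      hence "3 ^ n = real m * (N n + 1)" using mpos by (simp add: field_simps)
      hence "(3::int) ^ n = int m * (N n + 1)"
        by (metis of_int_eq_iff of_int_mult of_int_of_nat_eq of_int_power of_int_numeral of_int_add of_int_1)
      hence "int m dvd int (3 ^ n)" by simp
      thus False using m[of n] int_dvd_int_iff by blast
    qed
    ultimately show ?thesis by linarith
  qed
  show ?thesis
  proof
    fix j show "a j = (if j = 0 then 0 else \<lfloor>3 ^ j / real m\<rfloor> - 3 * \<lfloor>3 ^ (j - 1) / real m\<rfloor>)"
      by (cases j) (use fl in \<open>simp_all add: a0 NS del: power_Suc\<close>)
  qed
qed

lemma ternary_expansion_exists:
  assumes "m > 1"
  shows "is_ternary_expansion m
    (\<lambda>j. if j = 0 then 0 else \<lfloor>3 ^ j / real m\<rfloor> - 3 * \<lfloor>3 ^ (j - 1) / real m\<rfloor>)"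
proof -
  let ?a = "\<lambda>j. if j = 0 then 0 else \<lfloor>3 ^ j / real m\<rfloor> - 3 * \<lfloor>3 ^ (j - 1) / real m\<rfloor>"
  let ?x = "\<lambda>n. 3 ^ n / real m"
  have b: "0 \<le> ?a j \<and> ?a j < 3" if "j \<ge> 1" for j
  proof -
    from that obtain n where j: "j = Suc n" by (cases j) auto
    have "?x (Suc n) = 3 * ?x n" by simp
    hence "0 \<le> \<lfloor>?x (Suc n)\<rfloor> - 3 * \<lfloor>?x n\<rfloor> \<and> \<lfloor>?x (Suc n)\<rfloor> - 3 * \<lfloor>?x n\<rfloor> < 3" by linarith
    thus ?thesis by (simp add: j)
  qed
  have p: "(\<Sum>i<n. real_of_int (?a (Suc i)) / 3 ^ Suc i) = \<lfloor>?x n\<rfloor> / 3 ^ n" for n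
  proof (induction n)
    case 0 then show ?case using assms by (simp add: floor_eq_iff)
  next
    case (Suc n)
    then show ?case by (simp add: field_simps del: power_Suc) (simp add: field_simps)
  qed
  have "(\<lambda>n. \<lfloor>?x n\<rfloor> / 3 ^ n) \<longlonglongrightarrow> 1 / real m"
  proof (rule tendsto_sandwich)
    show "(\<lambda>n. 1 / real m - (1/3) ^ n) \<longlonglongrightarrow> 1 / real m"
      by (rule tendsto_eq_intros LIMSEQ_realpow_zero | simp)+
    show "(\<lambda>n. 1 / real m) \<longlonglongrightarrow> 1 / real m" by simp
    have "1 / real m - (1/3) ^ n = (?x n - 1) / 3 ^ n" for n
      by (simp add: diff_divide_distrib power_divide)
    thus "\<forall>\<^sub>F n in sequentially. 1 / real m - (1/3) ^ n \<le> \<lfloor>?x n\<rfloor> / 3 ^ n"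
      by (auto intro!: always_eventually divide_right_mono) 
    have "\<lfloor>?x n\<rfloor> / 3 ^ n \<le> ?x n / 3 ^ n" for n by (intro divide_right_mono) auto
    thus "\<forall>\<^sub>F n in sequentially. \<lfloor>?x n\<rfloor> / 3 ^ n \<le> 1 / real m"
      by (auto intro!: always_eventually)
  qed
  hence "(\<lambda>i. real_of_int (?a (Suc i)) / 3 ^ Suc i) sums (1 / real m)"
    unfolding sums_def p .
  thus ?thesis using b unfolding is_ternary_expansion_def by (intro conjI allI impI) (simp, blast, blast, assumption)
qed

lemma ternary_digit_well_defined:
  assumes "prime m" "m \<noteq> 3"
  shows "\<exists>!a. is_ternary_expansion m a" "is_ternary_expansion m (ternary_digit m)"
proof -
  have m: "\<not> m dvd 3 ^ n" for n
    using assms prime_dvd_power[of m 3 n] primes_dvd_imp_eq[of m 3] by auto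
  show *: "\<exists>!a. is_ternary_expansion m a"
  proof (rule ex1I)
    show "is_ternary_expansion m
        (\<lambda>j. if j = 0 then 0 else \<lfloor>3 ^ j / real m\<rfloor> - 3 * \<lfloor>3 ^ (j - 1) / real m\<rfloor>)"
      by (rule ternary_expansion_exists) (use assms prime_gt_1_nat in blast)
  qed (rule ternary_expansion_unique, assumption, rule prime_gt_0_nat[OF assms(1)], rule m)
  show "is_ternary_expansion m (ternary_digit m)"
    unfolding ternary_digit_def by (rule theI'[OF *])
qed

end

theory Submission
  imports Defs "HOL-Analysis.Harmonic_Numbers" "HOL-Real_Asymp.Real_Asymp"
begin

text \<open>
  Multiplying \<open>1/m\<close> by \<open>3\<^sup>k\<close> shifts its ternary expansion by \<open>k\<close> places, so the digit at
  position \<open>k + 1\<close> vanishes iff the fractional part of \<open>3\<^sup>k/m\<close> is below \<open>1/3\<close>, that is, iff the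
  residue of \<open>3\<^sup>k\<close> modulo \<open>m\<close> is below \<open>m/3\<close>. Even positions correspond to odd exponents
  \<open>k\<close>, and when \<open>3\<close> is a primitive root the odd powers of \<open>3\<close> are exactly the quadratic
  nonresidues. Hence \<open>\<sigma>(0,1)\<close> counts the quadratic nonresidues below \<open>m/3\<close>
  (\<open>sigma01_eq\<close>). There are about \<open>m/3\<close> residues below \<open>m/3\<close> in total, and half of them are
  nonresidues up to an error of half the character sum \<open>\<Sum>\<^sub>r (r/m)\<close> over that interval. The
  Polya--Vinogradov inequality bounds that sum by \<open>\<surd>m (1 + ln m)\<close>
  (\<open>polya_vinogradov_quadratic\<close>), which is \<open>O(m powr (1/2 + \<epsilon>))\<close>.

  With a primitive root \<open>g\<close> at hand, the quadratic character is just \<open>g\<^sup>k \<mapsto> (-1)\<^sup>k\<close>, and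
  everything is phrased in terms of the exponent \<open>k\<close>. Its finite Fourier transform is the Gauss
  sum \<open>G(a)\<close>. Substituting \<open>k + 1\<close> for \<open>k\<close> gives \<open>G(ag) = -G(a)\<close>
  (\<open>gauss_sum_times_generator\<close>), so \<open>|G|\<close> is constant away from \<open>0\<close>; since \<open>G(0) = 0\<close>,
  Parseval's identity forces that constant to be \<open>\<surd>p\<close> (\<open>norm_gauss_sum\<close>). Fourier inversion
  then writes the character sum over an interval as the average over \<open>a\<close> of \<open>G(a)\<close> times a
  geometric sum. The geometric sums have size \<open>O(p/a + p/(p - a))\<close>
  (\<open>norm_sum_additive_char_le\<close>), and adding these up gives the logarithm.
\<close>

section \<open>Additive characters of the integers modulo m\<close>

definition additive_char :: "nat \<Rightarrow> int \<Rightarrow> complex" where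
  "additive_char m n = cis (2 * pi * of_int n / of_nat m)"

lemma additive_char_0 [simp]: "additive_char m 0 = 1"
  by (simp add: additive_char_def)

lemma additive_char_add: "additive_char m (x + y) = additive_char m x * additive_char m y"
  by (simp add: additive_char_def cis_mult add_divide_distrib ring_distribs)

lemma cnj_additive_char: "cnj (additive_char m x) = additive_char m (- x)"
  by (simp add: additive_char_def cis_cnj)

lemma additive_char_power: "additive_char m (int k * x) = additive_char m x ^ k"
  unfolding additive_char_def Complex.DeMoivre by (simp add: mult_ac)

lemma additive_char_eq_1_iff:
  assumes "m > 0"
  shows "additive_char m x = 1 \<longleftrightarrow> int m dvd x"
proof -
  have "additive_char m x = 1 \<longleftrightarrow> (\<exists>n::int. 2 * pi * of_int x / of_nat m = of_int (2 * n) * pi)"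
    by (simp add: additive_char_def cis_conv_exp exp_eq_1)
  also have "\<dots> \<longleftrightarrow> (\<exists>n::int. real_of_int x = real_of_int (int m * n))"
    using assms by (simp add: field_simps)
  also have "\<dots> \<longleftrightarrow> int m dvd x"
    unfolding of_int_eq_iff dvd_def ..
  finally show ?thesis .
qed

lemma additive_char_cong:
  assumes "m > 0" "[x = y] (mod int m)"
  shows "additive_char m x = additive_char m y"
proof -
  have "additive_char m (x - y) = 1"
    using assms by (simp add: additive_char_eq_1_iff cong_iff_dvd_diff)
  thus ?thesis
    using additive_char_add[of m "x - y" y] by simp
qed

lemma additive_char_orthogonality:
  assumes "m > 0"
  shows "(\<Sum>a<m. additive_char m (int a * x) * cnj (additive_char m (int a * y))) =
           (if [x = y] (mod int m) then of_nat m else 0)"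
proof -
  let ?z = "additive_char m (x - y)"
  have "(\<Sum>a<m. additive_char m (int a * x) * cnj (additive_char m (int a * y))) = (\<Sum>a<m. ?z ^ a)"
    by (intro sum.cong refl)
       (simp add: cnj_additive_char right_diff_distrib
             flip: additive_char_add additive_char_power)
  also have "\<dots> = (if ?z = 1 then of_nat m else 0)"
  proof (cases "?z = 1")
    case False
    have "?z ^ m = 1"
      using assms by (simp add: additive_char_eq_1_iff flip: additive_char_power)
    thus ?thesis using False by (simp add: geometric_sum)
  qed simp
  finally show ?thesis
    using assms by (simp add: additive_char_eq_1_iff cong_iff_dvd_diff)
qed

text \<open>Jordan's inequality: \<open>sin\<close> is concave on \<open>[0, \<pi>/2]\<close>, so it lies above its chord.\<close>

lemma sin_ge_linear:
  fixes x :: real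
  assumes "0 \<le> x" "x \<le> pi / 2"
  shows "2 * x / pi \<le> sin x"
proof -
  have "convex_on {0..pi / 2} (\<lambda>x. - sin x)"
    by (rule f''_ge0_imp_convex[where f' = "\<lambda>x. - cos x" and f'' = sin])
       (auto intro!: derivative_eq_intros sin_ge_zero)
  from convex_onD[OF this, of "2 * x / pi" 0 "pi / 2"] assms show ?thesis
    by simp
qed

text \<open>
  By Jordan's inequality the chord from 1 to the root of unity has length at least
  \<open>4 min (a/m) ((m - a)/m)\<close>. The left side is twice the harmonic mean of these two numbers, which
  is at most four times their minimum; its reciprocal splits into two terms that are easy to sum
  over \<open>a\<close>.
\<close>

lemma norm_additive_char_minus_1:
  assumes "0 < a" "a < m"
  shows "4 / (real m / real a + real m / real (m - a)) \<le> norm (additive_char m (int a) - 1)"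
proof -
  have eq: "norm (additive_char m (int a) - 1) = 2 * \<bar>sin (pi * a / m)\<bar>"
    using dist_exp_i_1[of "2 * pi * a / m"] by (simp add: additive_char_def cis_conv_exp)
  \<comment> \<open>Reflecting \<open>a\<close> to the nearer of \<open>0\<close> and \<open>m\<close> puts the angle \<open>\<pi> b/m\<close> into \<open>[0, \<pi>/2]\<close>.\<close>
  define b where "b = min a (m - a)"
  have b: "0 < b" "2 * b \<le> m" "b = a \<or> b = m - a" using assms by (auto simp: b_def)
  have "sin (pi * b / m) = sin (pi * a / m)"
  proof (cases "b = a")
    case False
    hence "pi * b / m = pi - pi * a / m"
      using b(3) assms by (simp add: field_simps of_nat_diff)
    thus ?thesis by simp
  qed simp
  moreover have "2 * (pi * b / m) / pi \<le> sin (pi * b / m)"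
    using b assms by (intro sin_ge_linear) (auto simp: field_simps)
  ultimately have "2 * real b / m \<le> \<bar>sin (pi * a / m)\<bar>" by simp
  moreover have "1 / (real m / a + real m / (m - a)) \<le> b / m"
  proof -
    have "real m / b \<le> real m / a + real m / (m - a)"
      using b(3) by auto
    moreover have "real m / b > 0"
      using b assms by simp
    ultimately have "1 / (real m / a + real m / (m - a)) \<le> 1 / (real m / b)"
      by (intro frac_le) auto
    thus ?thesis by simp
  qed
  ultimately show ?thesis unfolding eq by simp
qed

text \<open>
  This is a geometric sum with ratio \<open>z \<noteq> 1\<close> of modulus 1, hence at most \<open>2 / |z - 1|\<close>,
  independently of its length.
\<close>

lemma norm_sum_additive_char_le:
  assumes "0 < a" "a < m"
  shows "norm (\<Sum>r<n. additive_char m (int a * int r)) \<le> (real m / real a + real m / real (m - a)) / 2"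
proof -
  let ?z = "additive_char m (int a)" and ?d = "real m / real a + real m / real (m - a)"
  have d: "?d > 0" using assms by (auto intro!: add_pos_pos)
  note lb = norm_additive_char_minus_1[OF assms]
  have pos: "4 / ?d > 0" using d by simp
  have "?z \<noteq> 1" using pos lb by auto
  have "(\<Sum>r<n. additive_char m (int a * int r)) = (\<Sum>r<n. ?z ^ r)"
    by (intro sum.cong refl) (simp add: mult.commute flip: additive_char_power)
  also have "\<dots> = (?z ^ n - 1) / (?z - 1)"
    using \<open>?z \<noteq> 1\<close> by (simp add: geometric_sum)
  also have "norm \<dots> = norm (?z ^ n - 1) / norm (?z - 1)"
    by (simp add: norm_divide)
  also have "\<dots> \<le> 2 / (4 / ?d)"
  proof (rule frac_le)
    have "norm (?z ^ n - 1) \<le> norm (?z ^ n) + norm (1 :: complex)"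
      by (rule norm_triangle_ineq4)
    thus "norm (?z ^ n - 1) \<le> 2" by (simp add: norm_power additive_char_def)
  qed (use pos lb in auto)
  finally show ?thesis by simp
qed

lemma sum_reciprocals_le:
  assumes "m > 0"
  shows "(\<Sum>a\<in>{1..<m}. real m / real a + real m / real (m - a)) \<le> 2 * real m * (1 + ln (real m))"
proof -
  have *: "(\<Sum>a\<in>{1..<m}. inverse (real a)) \<le> 1 + ln (real m)"
  proof -
    have "(\<Sum>a\<in>{1..<m}. inverse (real a)) \<le> harm m"
      unfolding harm_def by (intro sum_mono2) auto
    also have "harm m \<le> 1 + ln (real m)"
      using assms decseqD[OF decseq_harm_diff_ln, of 0 "m - 1"] by (simp add: harm_def)
    finally show ?thesis .
  qed
  have "(\<Sum>a\<in>{1..<m}. real m / real (m - a)) = (\<Sum>a\<in>{1..<m}. real m / real a)"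
    by (rule sum.reindex_bij_witness[of _ "\<lambda>a. m - a" "\<lambda>a. m - a"]) auto
  hence "(\<Sum>a\<in>{1..<m}. real m / real a + real m / real (m - a)) =
          2 * (\<Sum>a\<in>{1..<m}. real m / real a)"
    by (simp only: sum.distrib mult_2)
  also have "\<dots> = 2 * real m * (\<Sum>a\<in>{1..<m}. inverse (real a))"
    by (simp add: sum_distrib_left field_simps)
  also have "\<dots> \<le> 2 * real m * (1 + ln (real m))"
    by (intro mult_left_mono *) simp
  finally show ?thesis .
qed

section \<open>Quadratic Gauss sums\<close>

text \<open>
  For \<open>g\<close> a primitive root modulo the odd prime \<open>p\<close> the sign \<open>(-1)\<^sup>k\<close> is the Legendre symbol of
  \<open>g\<^sup>k\<close>, and this is the classical quadratic Gauss sum, with the nonzero residues enumerated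
  as powers of \<open>g\<close>.
\<close>

definition gauss_sum :: "nat \<Rightarrow> nat \<Rightarrow> int \<Rightarrow> complex" where
  "gauss_sum p g a = (\<Sum>k<p - 1. (-1) ^ k * additive_char p (a * int g ^ k))"

locale odd_prime_primroot =
  fixes p g :: nat
  assumes prime: "prime p" and odd: "odd p" and primroot: "residue_primroot p g"
begin

lemma p_gt_1: "p > 1" and p_pos [simp]: "p > 0"
  using prime_gt_1_nat[OF prime] by auto

lemma bij_betw_powers: "bij_betw (\<lambda>k. g ^ k mod p) {..<p - 1} {0<..<p}"
  using residue_primroot_is_generator[OF p_gt_1 primroot] prime
  by (simp add: totient_prime totatives_prime)

lemma cong_powers_iff:
  assumes "k < p - 1" "l < p - 1"
  shows "[int g ^ k = int g ^ l] (mod int p) \<longleftrightarrow> k = l"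
proof -
  have "[int g ^ k = int g ^ l] (mod int p) \<longleftrightarrow> g ^ k mod p = g ^ l mod p"
    using cong_int_iff[of "g ^ k" "g ^ l" p] by (simp add: unique_euclidean_semiring_class.cong_def)
  also have "\<dots> \<longleftrightarrow> k = l"
    using bij_betw_powers assms by (auto simp: bij_betw_def inj_on_def)
  finally show ?thesis .
qed

lemma gauss_sum_cong: "[a = b] (mod int p) \<Longrightarrow> gauss_sum p g a = gauss_sum p g b"
  unfolding gauss_sum_def
  by (intro sum.cong refl arg_cong2[where f = "(*)"] additive_char_cong cong_mult) auto

text \<open>
  Multiplication by \<open>g\<close> shifts the summation index. The sum is cyclic of length \<open>p - 1\<close> because
  \<open>g\<^sup>p\<^sup>-\<^sup>1\<close> is 1 modulo \<open>p\<close> and \<open>p - 1\<close> is even; the shift flips every sign.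
\<close>

lemma gauss_sum_times_generator: "gauss_sum p g (a * int g) = - gauss_sum p g a"
proof -
  let ?t = "\<lambda>k. (-1) ^ k * additive_char p (a * int g ^ k)"
  have "[g ^ (p - 1) = 1] (mod p)"
    using prime primroot by (intro fermat_theorem)
      (auto simp: residue_primroot_def coprime_absorb_left)
  hence "[int g ^ (p - 1) = 1] (mod int p)"
    using cong_int_iff[of "g ^ (p - 1)" 1 p] by simp
  hence "additive_char p (a * int g ^ (p - 1)) = additive_char p (a * 1)"
    by (intro additive_char_cong cong_mult) auto
  hence wrap: "?t (p - 1) = ?t 0"
    using odd by simp
  have "gauss_sum p g (a * int g) = - (\<Sum>k<p - 1. ?t (Suc k))"
    unfolding gauss_sum_def by (simp add: sum_negf mult_ac)
  also have "(\<Sum>k<p - 1. ?t (Suc k)) = (\<Sum>k<p - 1. ?t k)"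
    using sum.lessThan_Suc[of ?t "p - 1"] sum.lessThan_Suc_shift[of ?t "p - 1"] wrap by simp
  finally show ?thesis by (simp add: gauss_sum_def)
qed

lemma norm_gauss_sum_eq:
  assumes "0 < a" "a < p"
  shows "norm (gauss_sum p g (int a)) = norm (gauss_sum p g 1)"
proof -
  have "a \<in> (\<lambda>k. g ^ k mod p) ` {..<p - 1}"
    using bij_betw_powers assms by (simp add: bij_betw_def)
  then obtain k where k: "a = g ^ k mod p" by auto
  have "gauss_sum p g (int a) = gauss_sum p g (int g ^ k)"
    by (rule gauss_sum_cong) (simp add: k unique_euclidean_semiring_class.cong_def zmod_int)
  moreover have "norm (gauss_sum p g (int g ^ j)) = norm (gauss_sum p g 1)" for j
    by (induction j) (simp_all only: power_0 power_Suc2 gauss_sum_times_generator norm_minus_cancel)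
  ultimately show ?thesis by simp
qed

text \<open>
  Fourier inversion: the right side is \<open>p\<close> times the value at \<open>r\<close> of the quadratic character
  (at most one term of the sum is nonzero). It serves both in Parseval's identity and in the
  Polya--Vinogradov inequality.
\<close>

lemma gauss_sum_inversion:
  "(\<Sum>a<p. gauss_sum p g (int a) * cnj (additive_char p (int a * r))) =
     of_nat p * (\<Sum>k<p - 1. (-1) ^ k * of_bool ([int g ^ k = r] (mod int p)))"
proof -
  have "(\<Sum>a<p. gauss_sum p g (int a) * cnj (additive_char p (int a * r))) =
        (\<Sum>k<p - 1. (-1) ^ k *
          (\<Sum>a<p. additive_char p (int a * int g ^ k) * cnj (additive_char p (int a * r))))"
    unfolding gauss_sum_def sum_distrib_left sum_distrib_right
    by (subst sum.swap) (simp add: mult_ac)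
  also have "\<dots> = of_nat p * (\<Sum>k<p - 1. (-1) ^ k * of_bool ([int g ^ k = r] (mod int p)))"
    unfolding additive_char_orthogonality[OF p_pos] sum_distrib_left
    by (intro sum.cong refl) auto
  finally show ?thesis .
qed

lemma gauss_sum_0: "gauss_sum p g 0 = 0"
proof -
  have "even (p - 1)" using odd by simp
  thus ?thesis by (simp add: gauss_sum_def geometric_sum)
qed

text \<open>
  By Parseval the total of \<open>|G(a)|\<^sup>2\<close> is \<open>p (p - 1)\<close>. It is shared equally by the \<open>p - 1\<close>
  nonzero residues, since \<open>G(0) = 0\<close>.
\<close>

lemma norm_gauss_sum:
  assumes "0 < a" "a < p"
  shows "norm (gauss_sum p g (int a)) = sqrt (real p)"
proof -
  let ?G = "\<lambda>a::nat. gauss_sum p g (int a)"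
  have "of_real (\<Sum>a<p. norm (?G a) ^ 2) = (\<Sum>a<p. ?G a * cnj (?G a))"
    by (simp only: of_real_sum complex_norm_square)
  also have "\<dots> = (\<Sum>l<p - 1. (-1) ^ l *
      (\<Sum>a<p. ?G a * cnj (additive_char p (int a * int g ^ l))))"
    unfolding gauss_sum_def[of p g "int _", THEN arg_cong[where f = cnj]]
      sum_distrib_left cnj_sum
    by (subst sum.swap) (simp add: mult_ac)
  also have "\<dots> = (\<Sum>l<p - 1. (-1) ^ l * (of_nat p * (\<Sum>k<p - 1. (-1) ^ k * of_bool (k = l))))"
    unfolding gauss_sum_inversion
    by (intro sum.cong refl arg_cong2[where f = "(*)"]) (auto simp: cong_powers_iff)
  also have "\<dots> = (\<Sum>l<p - 1. of_nat p)"
    by (intro sum.cong refl) (auto simp: of_bool_def if_distrib cong: if_cong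
         simp flip: power_add mult_2)
  also have "\<dots> = of_real (real p * real (p - 1))"
    by simp
  finally have "(\<Sum>a<p. norm (?G a) ^ 2) = real p * real (p - 1)"
    unfolding of_real_eq_iff .
  also have "(\<Sum>a<p. norm (?G a) ^ 2) = (\<Sum>a\<in>{0<..<p}. norm (?G a) ^ 2)"
    by (rule sum.mono_neutral_right) (auto simp: gauss_sum_0 intro!: Nat.gr0I)
  also have "\<dots> = real (p - 1) * norm (gauss_sum p g 1) ^ 2"
    by (simp add: norm_gauss_sum_eq)
  finally have "norm (gauss_sum p g 1) ^ 2 = real p"
    using p_gt_1 by simp
  hence "norm (gauss_sum p g 1) = sqrt (real p)"
    by (metis norm_ge_zero real_sqrt_unique)
  thus ?thesis using norm_gauss_sum_eq[OF assms] by simp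
qed

section \<open>The Polya--Vinogradov inequality\<close>

text \<open>
  The sum is that of the quadratic character over the integers in \<open>[1, n - 1]\<close>. Expanding the
  indicator of the interval by \<open>gauss_sum_inversion\<close> gives a sum over \<open>a\<close> whose term at
  \<open>a = 0\<close> vanishes, and every other term is in absolute value \<open>\<surd>p\<close> times that of a geometric sum.
\<close>

lemma polya_vinogradov_quadratic:
  assumes "n \<le> p"
  shows "\<bar>\<Sum>k<p - 1. (-1) ^ k * of_bool (g ^ k mod p < n)\<bar> \<le> sqrt (real p) * (1 + ln (real p))"
proof -
  let ?T = "\<Sum>k<p - 1. (-1) ^ k * of_bool (g ^ k mod p < n) :: real"
  let ?K = "\<lambda>a::nat. \<Sum>r<n. additive_char p (int a * int r)"
  have ind: "of_bool (g ^ k mod p < n) = (\<Sum>r<n. of_bool ([int g ^ k = int r] (mod int p)) :: complex)" for k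
  proof -
    have "[int g ^ k = int r] (mod int p) \<longleftrightarrow> r = g ^ k mod p" if "r < n" for r
      using cong_int_iff[of "g ^ k" r p] that assms by (auto simp: unique_euclidean_semiring_class.cong_def)
    hence "(\<Sum>r<n. of_bool ([int g ^ k = int r] (mod int p)) :: complex) =
           (\<Sum>r<n. of_bool (r = g ^ k mod p))"
      by (intro sum.cong refl) auto
    thus ?thesis by (simp add: of_bool_def)
  qed
  have of_real_of_bool: "complex_of_real (of_bool P) = of_bool P" for P
    by simp
  have "of_nat p * of_real ?T =
      (\<Sum>r<n. of_nat p * (\<Sum>k<p - 1. (-1) ^ k * of_bool ([int g ^ k = int r] (mod int p))) :: complex)"
    unfolding of_real_sum of_real_mult of_real_of_bool ind sum_distrib_left
    by (subst sum.swap) simp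
  also have "\<dots> = (\<Sum>a<p. gauss_sum p g (int a) * cnj (?K a))"
    unfolding gauss_sum_inversion[symmetric] by (subst sum.swap) (simp add: sum_distrib_left)
  also have "\<dots> = (\<Sum>a\<in>{1..<p}. gauss_sum p g (int a) * cnj (?K a))"
    by (rule sum.mono_neutral_right) (auto simp: gauss_sum_0 not_le)
  finally have eq: "of_nat p * of_real ?T = (\<Sum>a\<in>{1..<p}. gauss_sum p g (int a) * cnj (?K a))" .
  have "real p * \<bar>?T\<bar> = norm (of_nat p * of_real ?T :: complex)"
    by (simp only: norm_mult norm_of_nat norm_of_real)
  also have "\<dots> \<le> (\<Sum>a\<in>{1..<p}. sqrt p * ((real p / real a + real p / real (p - a)) / 2))"
    unfolding eq
  proof (rule sum_norm_le)
    fix a assume a: "a \<in> {1..<p}"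
    have "norm (gauss_sum p g (int a) * cnj (?K a)) = sqrt p * norm (?K a)"
      using a by (simp add: norm_mult norm_gauss_sum del: cnj_sum)
    also have "\<dots> \<le> sqrt p * ((real p / real a + real p / real (p - a)) / 2)"
      using a by (intro mult_left_mono norm_sum_additive_char_le) auto
    finally show "norm (gauss_sum p g (int a) * cnj (?K a)) \<le> \<dots>" .
  qed
  also have "\<dots> = sqrt p / 2 * (\<Sum>a\<in>{1..<p}. real p / real a + real p / real (p - a))"
    by (simp add: sum_distrib_left)
  also have "\<dots> \<le> sqrt p / 2 * (2 * real p * (1 + ln p))"
    by (intro mult_left_mono sum_reciprocals_le) auto
  also have "\<dots> = real p * (sqrt p * (1 + ln p))"
    by (simp add: algebra_simps)
  finally have "real p * \<bar>?T\<bar> \<le> real p * (sqrt p * (1 + ln p))" .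
  thus ?thesis
    by (rule mult_left_le_imp_le) simp
qed

text \<open>
  The odd powers of \<open>g\<close> are the quadratic nonresidues. Of the \<open>n - 1\<close> nonzero residues below
  \<open>n\<close>, half are nonresidues, up to half the character sum over the interval.
\<close>

lemma card_odd_powers_below:
  assumes "0 < n" "n \<le> p"
  shows "\<bar>real (card {k. k < p - 1 \<and> odd k \<and> g ^ k mod p < n}) - (real n - 1) / 2\<bar>
           \<le> sqrt (real p) * (1 + ln (real p)) / 2"
proof -
  let ?r = "\<lambda>k. of_bool (g ^ k mod p < n) :: real"
  let ?T = "\<Sum>k<p - 1. (-1) ^ k * ?r k"
  have "(\<Sum>k<p - 1. ?r k) = (\<Sum>r\<in>{0<..<p}. of_bool (r < n))"
    by (rule sum.reindex_bij_betw[OF bij_betw_powers])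
  also have "\<dots> = real (card ({0<..<p} \<inter> {r. r < n}))"
    by (simp add: of_bool_def sum.If_cases)
  also have "{0<..<p} \<inter> {r. r < n} = {0<..<n}" using assms by auto
  also have "real (card {0<..<n}) = real n - 1" using assms by (simp add: of_nat_diff)
  finally have total: "(\<Sum>k<p - 1. ?r k) = real n - 1" .
  have "2 * real (card {k. k < p - 1 \<and> odd k \<and> g ^ k mod p < n}) =
          (\<Sum>k<p - 1. 2 * of_bool (odd k \<and> g ^ k mod p < n))"
    by (simp add: of_bool_def sum.If_cases Int_def flip: sum_distrib_left)
  also have "\<dots> = (\<Sum>k<p - 1. ?r k - (-1) ^ k * ?r k)"
    by (intro sum.cong refl) auto
  also have "\<dots> = real n - 1 - ?T"
    by (simp only: sum_subtractf total)
  finally have count: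
    "2 * real (card {k. k < p - 1 \<and> odd k \<and> g ^ k mod p < n}) = real n - 1 - ?T" .
  have halve: "\<bar>c - x / 2\<bar> \<le> B / 2" if "2 * c = x - T" "\<bar>T\<bar> \<le> B" for c x T B :: real
    using that by linarith
  show ?thesis
    by (rule halve[OF count polya_vinogradov_quadratic[OF assms(2)]])
qed

end

section \<open>Ternary digits and quadratic nonresidues\<close>

lemma ternary_digit_eq:
  assumes "prime m" "m \<noteq> 3"
  shows "ternary_digit m (Suc k) = \<lfloor>3 ^ Suc k / real m\<rfloor> - 3 * \<lfloor>3 ^ k / real m\<rfloor>"
proof -
  have "\<not> m dvd 3 ^ n" for n
    using assms prime_dvd_power[of m 3 n] primes_dvd_imp_eq[of m 3] by auto
  from ternary_expansion_unique[OF ternary_digit_well_defined(2)[OF assms]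
      prime_gt_0_nat[OF assms(1)] this]
  show ?thesis by (metis diff_Suc_1 nat.distinct(1))
qed

text \<open>
  One step of long division by \<open>m\<close> in base 3: the digit at position \<open>k + 1\<close> is the quotient of
  three times the remainder of \<open>3\<^sup>k\<close>. The factor \<open>m\<close>, being prime to 3, does not affect the
  congruence.
\<close>

lemma ternary_digit_eq_0_iff:
  assumes "prime m" "m \<noteq> 3"
  shows "[int m * ternary_digit m (Suc k) = 0] (mod 3) \<longleftrightarrow> 3 * (3 ^ k mod m) < m"
proof -
  let ?q = "3 ^ k div m" and ?r = "3 ^ k mod m"
  have m: "m > 0" using assms prime_gt_0_nat by blast
  have fl: "\<lfloor>3 ^ n / real m\<rfloor> = int (3 ^ n div m)" for n
    using floor_divide_of_nat_eq[of "3 ^ n" m, where ?'a = real] by simp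
  have "3 ^ Suc k = 3 * (m * ?q + ?r)"
    by (simp only: mult_div_mod_eq power_Suc)
  hence "3 ^ Suc k = 3 * ?r + m * (3 * ?q)"
    by (simp only: ring_distribs mult_ac add_ac)
  hence "3 ^ Suc k div m = 3 * ?q + 3 * ?r div m"
    using m by (metis div_mult_self2 less_numeral_extra(3) add.commute)
  hence digit: "ternary_digit m (Suc k) = int (3 * ?r div m)"
    unfolding ternary_digit_eq[OF assms] fl by simp
  have "3 * ?r div m < 3"
    using m by (intro less_mult_imp_div_less) simp
  have "coprime m 3" using assms primes_coprime[of m 3] by simp
  have "[int m * ternary_digit m (Suc k) = 0] (mod 3) \<longleftrightarrow> int 3 dvd int (m * (3 * ?r div m))"
    by (simp add: digit cong_0_iff)
  also have "\<dots> \<longleftrightarrow> 3 dvd 3 * ?r div m"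
    unfolding int_dvd_int_iff using \<open>coprime m 3\<close>
    by (simp add: coprime_dvd_mult_right_iff coprime_commute)
  also have "\<dots> \<longleftrightarrow> 3 * ?r div m = 0"
    using \<open>3 * ?r div m < 3\<close> by (auto dest: dvd_imp_le)
  also have "\<dots> \<longleftrightarrow> 3 * ?r < m"
    using m by (simp add: div_eq_0_iff)
  finally show ?thesis .
qed

text \<open>
  The integers \<open>r\<close> with \<open>3 r < m\<close> are those below \<open>m/3\<close> rounded up, which is \<open>(m + 2) div 3\<close>.
\<close>

lemma sigma01_eq:
  assumes "prime m" "m \<noteq> 3"
  shows "sigma01 m = card {k. k < m - 1 \<and> odd k \<and> 3 ^ k mod m < (m + 2) div 3}"
proof -
  let ?A = "{k. k < m - 1 \<and> odd k \<and> 3 ^ k mod m < (m + 2) div 3}"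
  have iff: "[int m * ternary_digit m (Suc k) = 0] (mod 3) \<longleftrightarrow> 3 ^ k mod m < (m + 2) div 3" for k
    unfolding ternary_digit_eq_0_iff[OF assms] by linarith
  have "{j \<in> {1..m - 1}. [int m * ternary_digit m j = 0] (mod 3) \<and> even j} = Suc ` ?A"
  proof (intro equalityI subsetI)
    fix j assume j: "j \<in> {j \<in> {1..m - 1}. [int m * ternary_digit m j = 0] (mod 3) \<and> even j}"
    then obtain k where "j = Suc k" by (cases j) auto
    thus "j \<in> Suc ` ?A" using j iff by auto
  qed (use iff in auto)
  thus ?thesis by (simp add: sigma01_def card_image)
qed

lemma sigma01_estimate:
  assumes "prime m" "odd m" "residue_primroot m 3"
  shows "\<bar>real (sigma01 m) - real m / 6\<bar> \<le> sqrt (real m) * (1 + ln (real m)) / 2 + 1 / 2"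
proof -
  interpret odd_prime_primroot m 3 by unfold_locales (use assms in auto)
  have "m \<noteq> 3" using assms(3) by (auto simp: residue_primroot_def)
  define n where "n = (m + 2) div 3"
  have n: "0 < n" "n \<le> m" "m \<le> 3 * n" "3 * n \<le> m + 2" using p_gt_1 by (auto simp: n_def)
  have "\<bar>(real n - 1) / 2 - real m / 6\<bar> \<le> 1 / 2"
  proof -
    have "real m \<le> 3 * real n" "3 * real n \<le> real m + 2" using n(3,4) by linarith+
    thus ?thesis unfolding abs_le_iff by (simp add: field_simps)
  qed
  thus ?thesis
    using card_odd_powers_below[OF n(1,2)] sigma01_eq[OF assms(1) \<open>m \<noteq> 3\<close>]
    unfolding n_def[symmetric] by linarith
qed

theorem corollary3p3:
  fixes \<epsilon> :: real
  assumes "\<epsilon> > 0"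
  shows "(\<lambda>m::nat. real (sigma01 m) - real m / 6)
    \<in> O[inf at_top (principal {m. prime m \<and> [m = 1] (mod 4) \<and> residue_primroot m 3})](\<lambda>m.
        real m powr (1 / 2 + \<epsilon>))"
proof -
  let ?F = "inf at_top (principal {m. prime m \<and> [m = 1] (mod 4) \<and> residue_primroot m 3})"
  let ?B = "\<lambda>m. sqrt (real m) * (1 + ln (real m)) / 2 + 1 / 2"
  have "(\<lambda>m. real (sigma01 m) - real m / 6) \<in> O[?F](?B)"
  proof (rule landau_o.big_mono)
    have "norm (real (sigma01 m) - real m / 6) \<le> norm (?B m)"
      if "prime m" "[m = 1] (mod 4)" "residue_primroot m 3" for m
    proof -
      have "m mod 4 = 1" using that(2) unfolding unique_euclidean_semiring_class.cong_def by simp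
      hence "odd m" by presburger
      from sigma01_estimate[OF that(1) this that(3)] show ?thesis by simp
    qed
    thus "\<forall>\<^sub>F m in ?F. norm (real (sigma01 m) - real m / 6) \<le> norm (?B m)"
      by (auto simp: eventually_inf_principal)
  qed
  moreover have "?B \<in> O(\<lambda>m::nat. real m powr (1 / 2 + \<epsilon>))"
    using assms by real_asymp
  hence "?B \<in> O[?F](\<lambda>m. real m powr (1 / 2 + \<epsilon>))"
    by (rule landau_o.big.filter_mono[rotated]) simp
  ultimately show ?thesis
    by (rule landau_o.big.trans)
qed

end
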